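(* If a TRS is incrementally polynomially terminating over $\mathbb{Q}$, then it is also incrementally polynomially terminating over $\mathbb{R}$.
   Context: For $D\in\{\mathbb{Q},\mathbb{R}\}$: $D_0=\{x\in D: x\ge0\}$; a polynomial interpretation over $D$ consists of $\delta\in D$, $\delta>0$, and for each $n$-ary symbol $f$ a polynomial $f_D\in D[x_1,\dots,x_n]$ with $f_D(D_0^n)\subseteq D_0$; its strict order is $x>y$ iff $x-y\ge\delta$ on $D_0$, its weak order is $\ge$ on $D_0$. Terms are evaluated under assignments into $D_0$. The interpretation is strictly (weakly) monotone if each $f_D$ is monotone in each argument w.r.t. the strict (weak) order, and (weakly) compatible with a TRS if $[\alpha](\ell)>[\alpha](r)$ ($\ge$) for all rules $\ell\to r$ and all assignments $\alpha$ into $D_0$. A TRS $\mathcal{R}$ is polynomially terminating over $D$ if some strictly monotone polynomial interpretation over $D$ is compatible with it. For $n\ge1$, $\mathcal{R}$ is polynomially terminating over $D$ in $n$ steps if either $n=1$ and $\mathcal{R}$ is polynomially terminating over $D$, or $n>1$ and there are a polynomial interpretation $\mathcal{P}$ over $D$ and nonempty $\mathcal{S}\subsetneq\mathcal{R}$ such that $\mathcal{P}$ is weakly and strictly monotone, weakly compatible with all rules of $\mathcal{R}$, compatible with all rules of $\mathcal{S}$, and $\mathcal{R}\setminus\mathcal{S}$ is polynomially terminating over $D$ in $n-1$ steps. $\mathcal{R}$ is incrementally polynomially terminating over $D$ if this holds for some $n\ge1$. *)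

theory Defs
  imports Complex_Main "HOL-Library.Poly_Mapping"
begin

datatype (syms_trm: 'f, vars_trm: 'v) trm = Var 'v | Fun 'f "('f, 'v) trm list"

type_synonym ('f, 'v) trs = "(('f, 'v) trm \<times> ('f, 'v) trm) set"

primrec wf_trm :: "'f set \<Rightarrow> ('f \<Rightarrow> nat) \<Rightarrow> ('f, 'v) trm \<Rightarrow> bool" where
  "wf_trm F ar (Var x) \<longleftrightarrow> True"
| "wf_trm F ar (Fun f ts) \<longleftrightarrow> f \<in> F \<and> length ts = ar f \<and> list_all (wf_trm F ar) ts"

definition is_trs :: "'f set \<Rightarrow> ('f \<Rightarrow> nat) \<Rightarrow> ('f, 'v) trs \<Rightarrow> bool" where
  "is_trs F ar R \<longleftrightarrow> (\<forall>(l, r) \<in> R. wf_trm F ar l \<and> wf_trm F ar r \<and>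
     (\<forall>x. l \<noteq> Var x) \<and> vars_trm r \<subseteq> vars_trm l)"

text \<open>A multivariate polynomial maps each monomial to its coefficient; a monomial maps each
  variable index to its exponent. The indeterminates are numbered from 0.\<close>

type_synonym 'd mpoly = "(nat \<Rightarrow>\<^sub>0 nat) \<Rightarrow>\<^sub>0 'd"

definition mpoly_vars :: "'d::zero mpoly \<Rightarrow> nat set" where
  "mpoly_vars p = (\<Union>m \<in> Poly_Mapping.keys p. Poly_Mapping.keys m)"

definition mpoly_eval :: "'d::comm_semiring_1 mpoly \<Rightarrow> 'd list \<Rightarrow> 'd" where
  "mpoly_eval p xs = (\<Sum>m \<in> Poly_Mapping.keys p. Poly_Mapping.lookup p m *
     (\<Prod>i \<in> Poly_Mapping.keys m. (xs ! i) ^ Poly_Mapping.lookup m i))"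

definition nonneg_tuples :: "nat \<Rightarrow> 'd::linordered_field list set" where
  "nonneg_tuples n = {xs. length xs = n \<and> set xs \<subseteq> {0..}}"

definition poly_interp :: "'f set \<Rightarrow> ('f \<Rightarrow> nat) \<Rightarrow> 'd::linordered_field \<Rightarrow> ('f \<Rightarrow> 'd mpoly) \<Rightarrow> bool" where
  "poly_interp F ar \<delta> P \<longleftrightarrow> \<delta> > 0 \<and>
     (\<forall>f \<in> F. mpoly_vars (P f) \<subseteq> {..<ar f} \<and> mpoly_eval (P f) ` nonneg_tuples (ar f) \<subseteq> {0..})"

definition strict_ord :: "'d::linordered_field \<Rightarrow> 'd \<Rightarrow> 'd \<Rightarrow> bool" where
  "strict_ord \<delta> x y \<longleftrightarrow> x \<in> {0..} \<and> y \<in> {0..} \<and> x - y \<ge> \<delta>"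

definition weak_ord :: "'d::linordered_field \<Rightarrow> 'd \<Rightarrow> bool" where
  "weak_ord x y \<longleftrightarrow> x \<in> {0..} \<and> y \<in> {0..} \<and> x \<ge> y"

definition monotone_interp ::
  "('d::linordered_field \<Rightarrow> 'd \<Rightarrow> bool) \<Rightarrow> 'f set \<Rightarrow> ('f \<Rightarrow> nat) \<Rightarrow> ('f \<Rightarrow> 'd mpoly) \<Rightarrow> bool" where
  "monotone_interp ord F ar P \<longleftrightarrow>
     (\<forall>f \<in> F. \<forall>xs \<in> nonneg_tuples (ar f). \<forall>i < ar f. \<forall>a \<in> {0..}. \<forall>b \<in> {0..}.
        ord a b \<longrightarrow> ord (mpoly_eval (P f) (xs[i := a])) (mpoly_eval (P f) (xs[i := b])))"

primrec eval_trm :: "('f \<Rightarrow> 'd::linordered_field mpoly) \<Rightarrow> ('v \<Rightarrow> 'd) \<Rightarrow> ('f, 'v) trm \<Rightarrow> 'd" where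
  "eval_trm P \<alpha> (Var x) = \<alpha> x"
| "eval_trm P \<alpha> (Fun f ts) = mpoly_eval (P f) (map (eval_trm P \<alpha>) ts)"

definition compatible_interp ::
  "('d::linordered_field \<Rightarrow> 'd \<Rightarrow> bool) \<Rightarrow> ('f \<Rightarrow> 'd mpoly) \<Rightarrow> ('f, 'v) trs \<Rightarrow> bool" where
  "compatible_interp ord P R \<longleftrightarrow>
     (\<forall>(l, r) \<in> R. \<forall>\<alpha>. range \<alpha> \<subseteq> {0..} \<longrightarrow> ord (eval_trm P \<alpha> l) (eval_trm P \<alpha> r))"

text \<open>The domain of the interpretations is given by the type argument
  (\<^typ>\<open>rat\<close> or \<^typ>\<open>real\<close>).\<close>

definition poly_terminating ::
  "'d::linordered_field itself \<Rightarrow> 'f set \<Rightarrow> ('f \<Rightarrow> nat) \<Rightarrow> ('f, 'v) trs \<Rightarrow> bool" where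
  "poly_terminating D F ar R \<longleftrightarrow>
     (\<exists>(\<delta> :: 'd) P. poly_interp F ar \<delta> P \<and> monotone_interp (strict_ord \<delta>) F ar P \<and>
        compatible_interp (strict_ord \<delta>) P R)"

fun poly_terminating_in ::
  "'d::linordered_field itself \<Rightarrow> 'f set \<Rightarrow> ('f \<Rightarrow> nat) \<Rightarrow> nat \<Rightarrow> ('f, 'v) trs \<Rightarrow> bool" where
  "poly_terminating_in D F ar 0 R \<longleftrightarrow> False"
| "poly_terminating_in D F ar (Suc 0) R \<longleftrightarrow> poly_terminating D F ar R"
| "poly_terminating_in D F ar (Suc (Suc n)) R \<longleftrightarrow>
     (\<exists>(\<delta> :: 'd) P S. poly_interp F ar \<delta> P \<and> S \<noteq> {} \<and> S \<subset> R \<and>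
        monotone_interp weak_ord F ar P \<and> monotone_interp (strict_ord \<delta>) F ar P \<and>
        compatible_interp weak_ord P R \<and> compatible_interp (strict_ord \<delta>) P S \<and>
        poly_terminating_in D F ar (Suc n) (R - S))"

definition incr_poly_terminating ::
  "'d::linordered_field itself \<Rightarrow> 'f set \<Rightarrow> ('f \<Rightarrow> nat) \<Rightarrow> ('f, 'v) trs \<Rightarrow> bool" where
  "incr_poly_terminating D F ar R \<longleftrightarrow> (\<exists>n \<ge> 1. poly_terminating_in D F ar n R)"

end

theory Submission
  imports Defs
begin

text \<open>
  The coefficients of a rational interpretation are read as real numbers. All requirements on an
  interpretation are non-strict polynomial inequalities (the strict order is \<open>x - y \<ge> \<delta>\<close>), and every
  admissible tuple of nonnegative reals is a limit of admissible tuples of nonnegative rationals,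
  so by continuity the requirements pass from the rationals to the reals, step by step.
\<close>

text \<open>Rounding up to a multiple of 1/(n+1) keeps nonnegative reals nonnegative, with error at
  most 1/(n+1). The shift by \<open>Suc\<close> avoids a zero denominator at n = 0.\<close>

definition upper_rat :: "nat \<Rightarrow> real \<Rightarrow> rat" where
  "upper_rat n x = of_int \<lceil>x * real (Suc n)\<rceil> / of_nat (Suc n)"

lemma upper_rat_nonneg: "0 \<le> upper_rat n x" if "0 \<le> x"
proof -
  have "0 \<le> x * real (Suc n)"
    using that by simp
  hence "0 \<le> \<lceil>x * real (Suc n)\<rceil>"
    by linarith
  thus ?thesis
    unfolding upper_rat_def by simp
qed

lemma upper_rat_tendsto: "(\<lambda>n. real_of_rat (upper_rat n x)) \<longlonglongrightarrow> x"
proof (rule tendsto_sandwich)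
  have eq: "real_of_rat (upper_rat n x) = real_of_int \<lceil>x * real (Suc n)\<rceil> / real (Suc n)" for n
    by (simp only: upper_rat_def of_rat_divide of_rat_of_int_eq of_rat_of_nat_eq)
  show "\<forall>\<^sub>F n in sequentially. x \<le> real_of_rat (upper_rat n x)"
    unfolding eq by (simp only: pos_le_divide_eq of_nat_0_less_iff zero_less_Suc
      le_of_int_ceiling eventually_True)
  have "real_of_rat (upper_rat n x) \<le> x + 1 / real (Suc n)" for n
  proof -
    have "real_of_int \<lceil>x * real (Suc n)\<rceil> \<le> x * real (Suc n) + 1"
      by (rule of_int_ceiling_le_add_one)
    hence "real_of_int \<lceil>x * real (Suc n)\<rceil> / real (Suc n) \<le> (x * real (Suc n) + 1) / real (Suc n)"
      by (rule divide_right_mono) simp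
    thus ?thesis
      unfolding eq by (simp add: add_divide_distrib del: of_nat_Suc)
  qed
  thus "\<forall>\<^sub>F n in sequentially. real_of_rat (upper_rat n x) \<le> x + 1 / real (Suc n)"
    by simp
  show "(\<lambda>n. x + 1 / real (Suc n)) \<longlonglongrightarrow> x"
    using tendsto_add[OF tendsto_const LIMSEQ_Suc[OF lim_1_over_n], of x] by simp
qed simp

definition real_mpoly :: "rat mpoly \<Rightarrow> real mpoly" where
  "real_mpoly = Poly_Mapping.map real_of_rat"

text \<open>\<open>Poly_Mapping.map\<close> acts on nonzero coefficients only; for absent monomials
  the equation holds because \<open>real_of_rat\<close> sends 0 to 0.\<close>

lemma lookup_real_mpoly:
  "Poly_Mapping.lookup (real_mpoly p) m = real_of_rat (Poly_Mapping.lookup p m)"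
  by (simp add: real_mpoly_def map.rep_eq when_def)

text \<open>The embedding is injective, so no coefficient vanishes. Hence rational and real
  evaluation sum over the same monomials and can be compared term by term.\<close>

lemma keys_real_mpoly: "Poly_Mapping.keys (real_mpoly p) = Poly_Mapping.keys p"
  by (auto simp: in_keys_iff lookup_real_mpoly)

lemma mpoly_vars_real_mpoly: "mpoly_vars (real_mpoly p) = mpoly_vars p"
  by (simp add: mpoly_vars_def keys_real_mpoly)

text \<open>The embedding commutes with finite sums, products and powers, which are continuous.
  Convergence is required only at the positions that the polynomial may read.\<close>

lemma mpoly_eval_tendsto:
  assumes vars: "mpoly_vars p \<subseteq> {..<k}"
    and lim: "\<And>i. i < k \<Longrightarrow> (\<lambda>n. real_of_rat (ys n ! i)) \<longlonglongrightarrow> xs ! i"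
  shows "(\<lambda>n. real_of_rat (mpoly_eval p (ys n))) \<longlonglongrightarrow> mpoly_eval (real_mpoly p) xs"
proof -
  have "i < k" if "m \<in> Poly_Mapping.keys p" "i \<in> Poly_Mapping.keys m" for m i
    using vars that unfolding mpoly_vars_def by blast
  thus ?thesis
    unfolding mpoly_eval_def keys_real_mpoly lookup_real_mpoly of_rat_sum of_rat_mult of_rat_prod
      of_rat_power
    by (intro tendsto_intros lim)
qed

text \<open>Structural induction, with continuity of the polynomial at each function symbol.
  Well-formedness puts the symbol into \<open>F\<close> and makes every position below its arity a
  valid index of the argument list.\<close>

lemma eval_trm_tendsto:
  assumes vars: "\<And>f. f \<in> F \<Longrightarrow> mpoly_vars (P f) \<subseteq> {..<ar f}"
    and lim: "\<And>x. (\<lambda>n. real_of_rat (\<beta> n x)) \<longlonglongrightarrow> \<alpha> x"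
    and wf: "wf_trm F ar t"
  shows "(\<lambda>n. real_of_rat (eval_trm P (\<beta> n) t)) \<longlonglongrightarrow> eval_trm (real_mpoly \<circ> P) \<alpha> t"
  using wf
proof (induction t)
  case (Var x)
  show ?case using lim by simp
next
  case (Fun f ts)
  show ?case
    unfolding eval_trm.simps o_def
  proof (rule mpoly_eval_tendsto)
    show "mpoly_vars (P f) \<subseteq> {..<ar f}"
      using Fun.prems vars by simp
    show "(\<lambda>n. real_of_rat (map (eval_trm P (\<beta> n)) ts ! i))
        \<longlonglongrightarrow> map (eval_trm (\<lambda>x. real_mpoly (P x)) \<alpha>) ts ! i" if "i < ar f" for i
      using Fun that by (simp add: o_def list_all_iff)
  qed
qed

text \<open>Lets each transfer lemma below serve both orders; for this reason they ask at most for a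
  nonnegative gap.\<close>

lemma weak_ord_eq_strict_ord_0: "weak_ord = strict_ord 0"
  by (intro ext) (auto simp: weak_ord_def strict_ord_def)

text \<open>The order is a conjunction of three non-strict inequalities, hence closed under
  limits.\<close>

lemma strict_ord_limit:
  assumes "\<And>n. strict_ord \<delta> (a n) (b n)"
    and a: "(\<lambda>n. real_of_rat (a n)) \<longlonglongrightarrow> x" and b: "(\<lambda>n. real_of_rat (b n)) \<longlonglongrightarrow> y"
  shows "strict_ord (real_of_rat \<delta>) x y"
proof -
  have "0 \<le> real_of_rat (a n)" "0 \<le> real_of_rat (b n)"
    "real_of_rat \<delta> \<le> real_of_rat (a n) - real_of_rat (b n)" for n
    using assms(1)[of n] by (simp_all add: strict_ord_def of_rat_less_eq flip: of_rat_diff)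
  thus ?thesis
    unfolding strict_ord_def
    using LIMSEQ_le_const[OF a] LIMSEQ_le_const[OF b] LIMSEQ_le_const[OF tendsto_diff[OF a b]]
    by auto
qed

lemma map_upper_rat_nonneg_tuples:
  "xs \<in> nonneg_tuples k \<Longrightarrow> map (upper_rat n) xs \<in> nonneg_tuples k"
  by (auto simp: nonneg_tuples_def intro!: upper_rat_nonneg)

lemma poly_interp_real:
  assumes "poly_interp F ar \<delta> P"
  shows "poly_interp F ar (real_of_rat \<delta>) (real_mpoly \<circ> P)"
  unfolding poly_interp_def
proof (intro conjI ballI image_subsetI)
  show "0 < real_of_rat \<delta>"
    using assms by (simp add: poly_interp_def)
  fix f assume f: "f \<in> F"
  show "mpoly_vars ((real_mpoly \<circ> P) f) \<subseteq> {..<ar f}"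
    using assms f by (simp add: poly_interp_def mpoly_vars_real_mpoly)
  fix xs :: "real list" assume xs: "xs \<in> nonneg_tuples (ar f)"
  have lim: "(\<lambda>n. real_of_rat (mpoly_eval (P f) (map (upper_rat n) xs)))
      \<longlonglongrightarrow> mpoly_eval (real_mpoly (P f)) xs"
  proof (rule mpoly_eval_tendsto)
    show "mpoly_vars (P f) \<subseteq> {..<ar f}"
      using assms f by (simp add: poly_interp_def)
  qed (use xs in \<open>simp add: nonneg_tuples_def upper_rat_tendsto\<close>)
  have "0 \<le> mpoly_eval (P f) (map (upper_rat n) xs)" for n
    using assms f map_upper_rat_nonneg_tuples[OF xs] unfolding poly_interp_def by fastforce
  thus "mpoly_eval ((real_mpoly \<circ> P) f) xs \<in> {0..}"
    using LIMSEQ_le_const[OF lim] by simp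
qed

text \<open>Rounding both compared arguments independently could shrink their gap below \<delta>,
  and then rational monotonicity would say nothing. The approximations are therefore chosen to keep
  the gap.\<close>

lemma monotone_interp_real:
  assumes vars: "\<And>f. f \<in> F \<Longrightarrow> mpoly_vars (P f) \<subseteq> {..<ar f}"
    and "0 \<le> \<delta>" and mono: "monotone_interp (strict_ord \<delta>) F ar P"
  shows "monotone_interp (strict_ord (real_of_rat \<delta>)) F ar (real_mpoly \<circ> P)"
  unfolding monotone_interp_def
proof (intro ballI allI impI)
  fix f xs i and a b :: real
  assume f: "f \<in> F" and xs: "(xs :: real list) \<in> nonneg_tuples (ar f)" and i: "i < ar f"
    and ab: "strict_ord (real_of_rat \<delta>) a b"
  \<comment> \<open>The surplus beyond the required gap: a = b + d + \<delta> with d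
    nonnegative.\<close>
  define d where "d = a - b - real_of_rat \<delta>"
  have "0 \<le> d" "0 \<le> b"
    using ab by (auto simp: d_def strict_ord_def)
  let ?b = "\<lambda>n. upper_rat n b"
  \<comment> \<open>Only b and d are rounded; \<delta> is already rational and stays exact, so
    \<open>?a n\<close> exceeds \<open>?b n\<close> by at least \<delta> for every n.\<close>
  let ?a = "\<lambda>n. ?b n + upper_rat n d + \<delta>"
  let ?xs = "\<lambda>n. map (upper_rat n) xs"
  have ord: "strict_ord \<delta> (?a n) (?b n)" for n
    using upper_rat_nonneg[OF \<open>0 \<le> d\<close>, of n] upper_rat_nonneg[OF \<open>0 \<le> b\<close>, of n] \<open>0 \<le> \<delta>\<close>
    by (simp add: strict_ord_def)
  have "(\<lambda>n. real_of_rat (?a n)) \<longlonglongrightarrow> b + d + real_of_rat \<delta>"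
    unfolding of_rat_add by (intro tendsto_intros upper_rat_tendsto)
  hence a: "(\<lambda>n. real_of_rat (?a n)) \<longlonglongrightarrow> a"
    by (simp add: d_def)
  have lim: "(\<lambda>n. real_of_rat (mpoly_eval (P f) ((?xs n)[i := c n])))
      \<longlonglongrightarrow> mpoly_eval (real_mpoly (P f)) (xs[i := z])"
    if "(\<lambda>n. real_of_rat (c n)) \<longlonglongrightarrow> z" for c z
    using xs i that
    by (intro mpoly_eval_tendsto[OF vars[OF f]])
      (auto simp: nonneg_tuples_def nth_list_update upper_rat_tendsto)
  have "strict_ord \<delta> (mpoly_eval (P f) ((?xs n)[i := ?a n])) (mpoly_eval (P f) ((?xs n)[i := ?b n]))"
    for n
  proof -
    have "?a n \<in> {0..}" "?b n \<in> {0..}"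
      using ord[of n] by (simp_all add: strict_ord_def)
    with mono f i map_upper_rat_nonneg_tuples[OF xs, of n] ord[of n] show ?thesis
      unfolding monotone_interp_def by blast
  qed
  from strict_ord_limit[OF this lim[OF a] lim[OF upper_rat_tendsto]]
  show "strict_ord (real_of_rat \<delta>) (mpoly_eval ((real_mpoly \<circ> P) f) (xs[i := a]))
      (mpoly_eval ((real_mpoly \<circ> P) f) (xs[i := b]))"
    by simp
qed

text \<open>The assignment is rounded variable by variable; pointwise convergence suffices for the
  values of both sides of a rule to converge.\<close>

lemma compatible_interp_real:
  assumes vars: "\<And>f. f \<in> F \<Longrightarrow> mpoly_vars (P f) \<subseteq> {..<ar f}"
    and trs: "is_trs F ar R" and comp: "compatible_interp (strict_ord \<delta>) P R"
  shows "compatible_interp (strict_ord (real_of_rat \<delta>)) (real_mpoly \<circ> P) R"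
proof -
  have "strict_ord (real_of_rat \<delta>) (eval_trm (real_mpoly \<circ> P) \<alpha> l) (eval_trm (real_mpoly \<circ> P) \<alpha> r)"
    if lr: "(l, r) \<in> R" and \<alpha>: "range \<alpha> \<subseteq> {0..}" for l r \<alpha>
  proof -
    let ?\<beta> = "\<lambda>n x. upper_rat n (\<alpha> x)"
    have "range (?\<beta> n) \<subseteq> {0..}" for n
      using \<alpha> by (auto intro!: upper_rat_nonneg)
    hence ord: "strict_ord \<delta> (eval_trm P (?\<beta> n) l) (eval_trm P (?\<beta> n) r)" for n
      using bspec[OF comp[unfolded compatible_interp_def] lr] by simp
    have wf: "wf_trm F ar l" "wf_trm F ar r"
      using trs lr unfolding is_trs_def by auto
    have lim: "(\<lambda>n. real_of_rat (eval_trm P (?\<beta> n) t)) \<longlonglongrightarrow> eval_trm (real_mpoly \<circ> P) \<alpha> t"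
      if "wf_trm F ar t" for t
      using vars upper_rat_tendsto that by (rule eval_trm_tendsto)
    show ?thesis
      by (rule strict_ord_limit[OF ord lim[OF wf(1)] lim[OF wf(2)]])
  qed
  thus ?thesis
    unfolding compatible_interp_def by blast
qed

lemma poly_interp_vars:
  "poly_interp F ar \<delta> P \<Longrightarrow> f \<in> F \<Longrightarrow> mpoly_vars (P f) \<subseteq> {..<ar f}"
  by (simp add: poly_interp_def)

lemma is_trs_subset: "is_trs F ar R \<Longrightarrow> S \<subseteq> R \<Longrightarrow> is_trs F ar S"
  unfolding is_trs_def by blast

lemma poly_terminating_real:
  assumes "is_trs F ar R" "poly_terminating TYPE(rat) F ar R"
  shows "poly_terminating TYPE(real) F ar R"
proof -
  obtain \<delta> :: rat and P where P: "poly_interp F ar \<delta> P" "monotone_interp (strict_ord \<delta>) F ar P"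
    "compatible_interp (strict_ord \<delta>) P R"
    using assms(2) unfolding poly_terminating_def by blast
  have "0 \<le> \<delta>"
    using P(1) by (simp add: poly_interp_def)
  note vars = poly_interp_vars[OF P(1)]
  show ?thesis
    unfolding poly_terminating_def
    using poly_interp_real[OF P(1)] monotone_interp_real[OF vars \<open>0 \<le> \<delta>\<close> P(2)]
      compatible_interp_real[OF vars assms(1) P(3)]
    by blast
qed

text \<open>The number of steps and the set of rules removed at each step stay the same; only the
  interpretations are embedded into the reals.\<close>

lemma poly_terminating_in_real:
  assumes "is_trs F ar R" "poly_terminating_in TYPE(rat) F ar n R"
  shows "poly_terminating_in TYPE(real) F ar n R"
  using assms
\<comment> \<open>This rule matches the three defining equations. \<open>R\<close> is generalized
  because the recursion continues with \<open>R - S\<close>.\<close>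
proof (induction n arbitrary: R rule: induct_nat_012)
  case 0
  thus ?case by simp
next
  case 1
  thus ?case using poly_terminating_real by simp
next
  case (ge2 n)
  obtain \<delta> :: rat and P S where P: "poly_interp F ar \<delta> P"
    and S: "S \<noteq> {}" "S \<subset> R"
    and mono: "monotone_interp (strict_ord 0) F ar P" "monotone_interp (strict_ord \<delta>) F ar P"
    and comp: "compatible_interp (strict_ord 0) P R" "compatible_interp (strict_ord \<delta>) P S"
    and rest: "poly_terminating_in TYPE(rat) F ar (Suc n) (R - S)"
    using ge2.prems(2) unfolding weak_ord_eq_strict_ord_0[symmetric] by auto
  have "0 \<le> \<delta>"
    using P by (simp add: poly_interp_def)
  have trs: "is_trs F ar S" "is_trs F ar (R - S)"
    using S(2) by (auto intro: is_trs_subset[OF ge2.prems(1)])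
  note vars = poly_interp_vars[OF P]
  have "monotone_interp weak_ord F ar (real_mpoly \<circ> P)"
    "compatible_interp weak_ord (real_mpoly \<circ> P) R"
    unfolding weak_ord_eq_strict_ord_0
    using monotone_interp_real[OF vars order_refl mono(1)]
      compatible_interp_real[OF vars ge2.prems(1) comp(1)] by simp_all
  moreover have "poly_terminating_in TYPE(real) F ar (Suc n) (R - S)"
    \<comment> \<open>The second induction hypothesis is the one for \<open>Suc n\<close>.\<close>
    using ge2.IH(2) trs(2) rest by blast
  ultimately show ?case
    using poly_interp_real[OF P] monotone_interp_real[OF vars \<open>0 \<le> \<delta>\<close> mono(2)]
      compatible_interp_real[OF vars trs(1) comp(2)] S
    unfolding poly_terminating_in.simps by blast
qed

theorem theorem6p6:
  fixes F :: "'f set" and ar :: "'f \<Rightarrow> nat" and R :: "('f, 'v) trs"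
  assumes "is_trs F ar R"
    and "incr_poly_terminating TYPE(rat) F ar R"
  shows "incr_poly_terminating TYPE(real) F ar R"
  using assms poly_terminating_in_real unfolding incr_poly_terminating_def by blast

end
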